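(* Let $V$ be a finite set with $n=|V|$. Any algorithm that solves the posimodular function maximization problem on $V$ — i.e., given value-oracle access to an arbitrary posimodular function $f:2^V\to\mathbb{R}_+$, outputs a nonempty subset $X\subseteq V$ maximizing $f$ together with the optimal value — requires at least $2^{n-1}$ oracle calls in the worst case.
   Context: A set function $f:2^V\to\mathbb{R}$ is posimodular if $f(X)+f(Y)\ge f(X\setminus Y)+f(Y\setminus X)$ for all $X,Y\subseteq V$. The function is accessible only through an oracle returning $f(X)$ for a queried $X\subseteq V$. *)

theory Defs
  imports Complex_Main
begin

definition posimodular_on :: "'a set \<Rightarrow> ('a set \<Rightarrow> real) \<Rightarrow> bool" where
  "posimodular_on V f \<longleftrightarrow>
     (\<forall>X Y. X \<subseteq> V \<longrightarrow> Y \<subseteq> V \<longrightarrow> f X + f Y \<ge> f (X - Y) + f (Y - X))"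

definition nonneg_posimodular_on :: "'a set \<Rightarrow> ('a set \<Rightarrow> real) \<Rightarrow> bool" where
  "nonneg_posimodular_on V f \<longleftrightarrow> posimodular_on V f \<and> (\<forall>X. X \<subseteq> V \<longrightarrow> 0 \<le> f X)"

text \<open>
  A deterministic adaptive algorithm in the value-oracle model is an arbitrary (not necessarily
  computable) map from the list of query-answer pairs obtained so far, oldest first, to its next
  action: either query the oracle at a set, or stop and output a set together with a value.
\<close>

datatype 'a action = Query "'a set" | Output "'a set" real

type_synonym 'a algorithm = "('a set \<times> real) list \<Rightarrow> 'a action"

text \<open>
  The predicate below holds of the histories reached when \<open>A\<close> runs on the oracle for \<open>f\<close>.  The
  oracle only answers queries \<open>X \<subseteq> V\<close>; on any other query the run is stuck and never halts.  A run
  may also be infinite.  Every call is recorded, so the number of oracle calls made so far is the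
  length of the history.
\<close>

inductive reaches :: "'a set \<Rightarrow> 'a algorithm \<Rightarrow> ('a set \<Rightarrow> real) \<Rightarrow> ('a set \<times> real) list \<Rightarrow> bool"
  for V A f where
  start: "reaches V A f []"
| call: "reaches V A f h \<Longrightarrow> A h = Query X \<Longrightarrow> X \<subseteq> V \<Longrightarrow> reaches V A f (h @ [(X, f X)])"

definition halts_with ::
    "'a set \<Rightarrow> 'a algorithm \<Rightarrow> ('a set \<Rightarrow> real) \<Rightarrow> nat \<Rightarrow> 'a set \<Rightarrow> real \<Rightarrow> bool" where
  "halts_with V A f q X v \<longleftrightarrow> (\<exists>h. reaches V A f h \<and> A h = Output X v \<and> length h = q)"

definition solves_posimodular_max :: "'a set \<Rightarrow> 'a algorithm \<Rightarrow> bool" where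
  "solves_posimodular_max V A \<longleftrightarrow>
     (\<forall>f. nonneg_posimodular_on V f \<longrightarrow>
       (\<exists>q X v. halts_with V A f q X v \<and>
          X \<noteq> {} \<and> X \<subseteq> V \<and> (\<forall>Y. Y \<noteq> {} \<longrightarrow> Y \<subseteq> V \<longrightarrow> f Y \<le> f X) \<and> v = f X))"

end

theory Submission
  imports Defs "HOL-Library.Sublist"
begin

text \<open>
  Let \<open>m = \<lceil>n/2\<rceil>\<close> and run the algorithm on the truncated cardinality \<open>g X = min |X| m\<close>.  Every
  set with at least \<open>m\<close> elements maximizes \<open>g\<close>, and there are at least \<open>2 ^ (n - 1)\<close> such sets,
  since a set or its complement is one of them.  Raising the value of any single such set \<open>S\<close> by
  one preserves posimodularity: if \<open>X - Y = S\<close> and \<open>X\<close>, \<open>Y\<close> meet, then \<open>Y - X\<close> has fewer than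
  \<open>m\<close> elements, so \<open>g Y \<ge> g (Y - X) + 1\<close>.  The raised function has a larger maximum, so a run that
  leaves \<open>S\<close> unqueried would give a wrong answer on one of the two functions.
\<close>

text \<open>Histories grow only at the end, so induction from the right strips \<open>t\<close> and
  leaves the call made directly after \<open>h\<close>.\<close>

lemma reaches_appendD:
  assumes "reaches V A f (h @ a # t)"
  shows "\<exists>X. A h = Query X \<and> a = (X, f X)"
  using assms
proof (induction t rule: rev_induct)
  case Nil
  then show ?case by (auto elim: reaches.cases)
next
  case (snoc b t)
  from snoc.prems have "reaches V A f (h @ a # t)"
    by cases auto
  then show ?case by (rule snoc.IH)
qed

text \<open>Determinism: a query made at a proper prefix of \<open>h'\<close> is the one that
  \<open>h'\<close> records next, with the same answer; and no query follows \<open>h'\<close>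
  itself, where \<open>A\<close> stops.\<close>

lemma reaches_prefix_halted:
  assumes "reaches V A f h" "reaches V A f h'" "A h' = Output X v"
  shows "prefix h h'"
  using assms(1)
proof induction
  case start
  then show ?case by simp
next
  case (call h Y)
  then obtain t where t: "h' = h @ t" by (auto elim: prefixE)
  with call.hyps(2) assms(3) obtain b u where "t = b # u" by (cases t) auto
  with t reaches_appendD[of V A f h b u] assms(2) call.hyps(2) show ?case
    by auto
qed

lemma reaches_halted_unique:
  assumes "reaches V A f h" "A h = Output X v"
    and "reaches V A f h'" "A h' = Output X' v'"
  shows "h = h'"
  using assms by (meson prefix_order.antisym reaches_prefix_halted)

lemma solves_posimodular_maxE:
  assumes "solves_posimodular_max V A" "nonneg_posimodular_on V f"
  obtains h X where "reaches V A f h" "A h = Output X (f X)" "X \<noteq> {}" "X \<subseteq> V"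
    "\<forall>Y. Y \<noteq> {} \<longrightarrow> Y \<subseteq> V \<longrightarrow> f Y \<le> f X"
proof -
  from assms have "\<exists>q X v. halts_with V A f q X v \<and> X \<noteq> {} \<and> X \<subseteq> V \<and>
      (\<forall>Y. Y \<noteq> {} \<longrightarrow> Y \<subseteq> V \<longrightarrow> f Y \<le> f X) \<and> v = f X"
    unfolding solves_posimodular_max_def by (elim allE impE)
  then obtain q X v where X: "halts_with V A f q X v" "X \<noteq> {}" "X \<subseteq> V"
    "\<forall>Y. Y \<noteq> {} \<longrightarrow> Y \<subseteq> V \<longrightarrow> f Y \<le> f X" "v = f X"
    by (elim exE conjE)
  from X(1) obtain h where "reaches V A f h" "A h = Output X v"
    unfolding halts_with_def by meson
  with X that show thesis by simp
qed

text \<open>The algorithm sees the function only through the recorded answers, so it cannot tell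
  apart two functions that agree on all queried sets.\<close>

lemma reaches_cong:
  assumes "reaches V A f h" "\<And>X. X \<in> fst ` set h \<Longrightarrow> f X = g X"
  shows "reaches V A g h"
  using assms
proof induction
  case start
  show ?case by (rule reaches.start)
next
  case (call h X)
  then have "reaches V A g h" by simp
  from this call.hyps(2,3) have "reaches V A g (h @ [(X, g X)])" by (rule reaches.call)
  with call.prems show ?case by simp
qed

definition truncated_card :: "nat \<Rightarrow> 'a set \<Rightarrow> real" where
  "truncated_card m X = real (min (card X) m)"

lemma truncated_card_mono:
  "finite Y \<Longrightarrow> X \<subseteq> Y \<Longrightarrow> truncated_card m X \<le> truncated_card m Y"
  unfolding truncated_card_def using card_mono[of Y X] by auto

text \<open>Any monotone function is posimodular, because \<open>X - Y\<close> lies in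
  \<open>X\<close> and \<open>Y - X\<close> lies in \<open>Y\<close>.\<close>

lemma truncated_card_posimodular:
  assumes "finite V"
  shows "nonneg_posimodular_on V (truncated_card m)"
proof -
  have "truncated_card m (X - Y) + truncated_card m (Y - X)
      \<le> truncated_card m X + truncated_card m Y" if "X \<subseteq> V" "Y \<subseteq> V" for X Y
    using assms that by (intro add_mono truncated_card_mono) (auto intro: finite_subset)
  then show ?thesis
    by (simp add: nonneg_posimodular_on_def posimodular_on_def truncated_card_def)
qed

text \<open>The unit of slack comes from \<open>Y\<close>: both \<open>X\<close> and
  \<open>X - Y\<close> are truncated to \<open>m\<close>, while \<open>card X > m\<close> leaves
  fewer than \<open>m\<close> elements for \<open>Y - X\<close>, so adding the common elements to
  \<open>Y - X\<close> raises its value.\<close>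

lemma truncated_card_slack:
  assumes "finite V" "X \<subseteq> V" "Y \<subseteq> V" "X \<inter> Y \<noteq> {}"
    and "m \<le> card (X - Y)" "card V \<le> 2 * m"
  shows "truncated_card m (X - Y) + 1 + truncated_card m (Y - X)
    \<le> truncated_card m X + truncated_card m Y"
proof -
  have fin: "finite X" "finite Y" using assms finite_subset by auto
  have "card X + card (Y - X) = card (X \<union> Y)"
    using fin card_Un_disjoint[of X "Y - X"] by simp
  also have "\<dots> \<le> card V" using assms by (intro card_mono) auto
  finally have un: "card X + card (Y - X) \<le> card V" .
  have X: "card X = card (X - Y) + card (X \<inter> Y)"
    using fin by (metis add.commute card_Int_Diff)
  have Y: "card Y = card (Y - X) + card (X \<inter> Y)"
    using fin by (metis add.commute card_Int_Diff Int_commute)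
  have "card (X \<inter> Y) > 0" using fin assms(4) by (simp add: card_gt_0_iff)
  with un X Y assms(5,6) have "min (card (X - Y)) m + 1 + min (card (Y - X)) m
      \<le> min (card X) m + min (card Y) m"
    by linarith
  then show ?thesis unfolding truncated_card_def by linarith
qed

lemma raised_truncated_card_posimodular:
  assumes V: "finite V" and S: "m \<le> card S" and m: "0 < m" "card V \<le> 2 * m"
  shows "nonneg_posimodular_on V ((truncated_card m)(S := truncated_card m S + 1))"
    (is "nonneg_posimodular_on V ?f")
proof -
  let ?g = "truncated_card m"
  have "S \<noteq> {}" using S m by auto
  have ge: "?g X \<le> ?f X" for X by simp
  have base: "?g (X - Y) + ?g (Y - X) \<le> ?g X + ?g Y" if "X \<subseteq> V" "Y \<subseteq> V" for X Y
    using truncated_card_posimodular[OF V, of m] that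
    by (simp add: nonneg_posimodular_on_def posimodular_on_def)
  have raised: "?f (X - Y) + ?f (Y - X) \<le> ?f X + ?f Y"
    if "X \<subseteq> V" "Y \<subseteq> V" "X - Y = S" for X Y
  proof (cases "X \<inter> Y = {}")
    case True
    then have "X - Y = X" "Y - X = Y" by auto
    then show ?thesis by simp
  next
    case False
    \<comment> \<open>\<open>Y - X\<close> is disjoint from the nonempty set
      \<open>X - Y = S\<close>, so the raise counts only once on the smaller side.\<close>
    have "Y - X \<noteq> S" using that \<open>S \<noteq> {}\<close> by auto
    then have "?f (X - Y) + ?f (Y - X) = ?g (X - Y) + 1 + ?g (Y - X)"
      using that by simp
    also have "\<dots> \<le> ?g X + ?g Y"
      using truncated_card_slack[OF V _ _ False _ m(2)] that S by simp
    also have "\<dots> \<le> ?f X + ?f Y" by (intro add_mono ge)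
    finally show ?thesis .
  qed
  have "?f (X - Y) + ?f (Y - X) \<le> ?f X + ?f Y" if XY: "X \<subseteq> V" "Y \<subseteq> V" for X Y
  proof (cases "X - Y = S \<or> Y - X = S")
    case True
    \<comment> \<open>The inequality is symmetric in \<open>X\<close> and \<open>Y\<close>, so the
      second case is \<open>raised\<close> with the two sets exchanged.\<close>
    then show ?thesis
      using raised[OF XY] raised[OF XY(2,1)] by (auto simp only: add.commute)
  next
    case False
    then have "?f (X - Y) + ?f (Y - X) = ?g (X - Y) + ?g (Y - X)" by simp
    also note base[OF XY]
    also have "?g X + ?g Y \<le> ?f X + ?f Y" by (intro add_mono ge)
    finally show ?thesis .
  qed
  then show ?thesis
    by (simp add: nonneg_posimodular_on_def posimodular_on_def truncated_card_def)
qed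

lemma card_large_subsets:
  assumes "finite V" "2 * m \<le> card V + 1"
  shows "2 ^ (card V - 1) \<le> card {S. S \<subseteq> V \<and> m \<le> card S}" (is "_ \<le> card ?L")
proof -
  have fin: "finite ?L" using assms(1) by simp
  have "Pow V \<subseteq> ?L \<union> (\<lambda>S. V - S) ` ?L"
  proof
    fix X assume "X \<in> Pow V"
    then have X: "X \<subseteq> V" "V - (V - X) = X" by auto
    have "card (V - X) = card V - card X" "card X \<le> card V"
      using assms(1) X(1) by (auto intro: card_Diff_subset card_mono finite_subset)
    \<comment> \<open>If both sizes were at most \<open>m - 1\<close>, they would add up to at most
      \<open>2 * m - 2\<close>, which is less than \<open>card V\<close>.\<close>
    then have "m \<le> card X \<or> m \<le> card (V - X)" using assms(2) by linarith
    then show "X \<in> ?L \<union> (\<lambda>S. V - S) ` ?L"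
      using X by (auto intro!: image_eqI[of X _ "V - X"])
  qed
  then have "card (Pow V) \<le> card (?L \<union> (\<lambda>S. V - S) ` ?L)"
    using fin by (intro card_mono) auto
  also have "\<dots> \<le> card ?L + card ?L"
    by (rule order_trans[OF card_Un_le add_left_mono[OF card_image_le[OF fin]]])
  finally have le: "2 ^ card V \<le> 2 * card ?L"
    using assms(1) by (simp add: card_Pow)
  show ?thesis
  proof (cases "card V")
    \<comment> \<open>Here the exponent \<open>card V - 1\<close> is truncated to 0, and
      \<open>le\<close> still forces \<open>?L\<close> to be nonempty.\<close>
    case 0
    with le show ?thesis by simp
  next
    case (Suc k)
    with le show ?thesis by simp
  qed
qed

theorem theorem5:
  fixes V :: "'a set" and A :: "'a algorithm"
  assumes "finite V"
    and "solves_posimodular_max V A"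
  shows "\<exists>f. nonneg_posimodular_on V f \<and>
    (\<exists>q X v. halts_with V A f q X v \<and> 2 ^ (card V - 1) \<le> q)"
proof -
  \<comment> \<open>Rounding up meets both needs: \<open>card V \<le> 2 * m\<close> for the raise
    and \<open>2 * m \<le> card V + 1\<close> for the count.\<close>
  define m where "m = (card V + 1) div 2"
  define g :: "'a set \<Rightarrow> real" where "g = truncated_card m"
  let ?L = "{S. S \<subseteq> V \<and> m \<le> card S}"
  have g: "nonneg_posimodular_on V g"
    unfolding g_def using assms(1) by (rule truncated_card_posimodular)
  with assms(2) obtain h X where h: "reaches V A g h" "A h = Output X (g X)"
    and X: "X \<noteq> {}" "X \<subseteq> V"
    by (rule solves_posimodular_maxE)
  have "card V > 0" using X assms(1) by (auto simp: card_gt_0_iff)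
  then have m: "0 < m" "card V \<le> 2 * m" "2 * m \<le> card V + 1"
    unfolding m_def by auto
  have "?L \<subseteq> fst ` set h"
  proof
    fix S assume S: "S \<in> ?L"
    show "S \<in> fst ` set h"
    proof (rule ccontr)
      assume unqueried: "S \<notin> fst ` set h"
      let ?f = "g(S := g S + 1)"
      have f: "nonneg_posimodular_on V ?f"
        unfolding g_def using S m assms(1)
        by (intro raised_truncated_card_posimodular) auto
      from assms(2) f obtain h' X' where h': "reaches V A ?f h'" "A h' = Output X' (?f X')"
        and "X' \<noteq> {}" "X' \<subseteq> V" and max: "\<forall>Y. Y \<noteq> {} \<longrightarrow> Y \<subseteq> V \<longrightarrow> ?f Y \<le> ?f X'"
        by (rule solves_posimodular_maxE)
      have "reaches V A ?f h"
        using h(1)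
      proof (rule reaches_cong)
        show "g Y = ?f Y" if "Y \<in> fst ` set h" for Y
          using that unqueried by (cases "Y = S") simp_all
      qed
      from reaches_halted_unique[OF this h(2) h'] have "h = h'" .
      \<comment> \<open>Equal histories give equal outputs, so the value reported for
        \<open>g\<close> is also the claimed maximum of \<open>?f\<close>.\<close>
      with h(2) h'(2) have "?f X' = g X" by (metis action.inject(2))
      also have "\<dots> \<le> real m" by (simp add: g_def truncated_card_def)
      also have "\<dots> < ?f S" using S by (simp add: g_def truncated_card_def)
      also have "\<dots> \<le> ?f X'"
      proof (rule max[rule_format])
        show "S \<noteq> {}" "S \<subseteq> V" using S m(1) by auto
      qed
      finally show False by simp
    qed
  qed
  then have "card ?L \<le> card (fst ` set h)" by (intro card_mono) auto
  \<comment> \<open>Repeated queries only lengthen the history.\<close>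
  also have "\<dots> \<le> length h"
    using card_length[of "map fst h"] by simp
  finally have "2 ^ (card V - 1) \<le> length h"
    using card_large_subsets[OF assms(1) m(3)] by linarith
  moreover from h have "halts_with V A g (length h) X (g X)"
    unfolding halts_with_def by metis
  ultimately show ?thesis using g by metis
qed

end
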